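(* Let $R$ be an integral domain of characteristic $0$ with $\mathrm{Jac}(R)=0$ such that $\mathrm{char}(R/\mathfrak{m})>0$ for all maximal ideals $\mathfrak{m}$ of $R$. Let $H$ be an $R$-algebra that is free of finite rank as an $R$-module. Then for any faithful left $H$-module $M$ that is free as an $R$-module and any number $q>1$, there exists a set $Y$ of maximal ideals of $R$ such that: (1) $M/\mathfrak{m}M$ is a faithful $H/\mathfrak{m}H$-module for any $\mathfrak{m}\in Y$; (2) $\mathrm{char}(R/\mathfrak{m})>q$ for any $\mathfrak{m}\in Y$; (3) the canonical homomorphism of $R$-algebras $\Psi: H\longrightarrow \prod_{\mathfrak{m}\in Y} H/\mathfrak{m}H$ is injective.
   Context: $R$ is commutative and $\mathrm{Jac}(R)$ denotes its Jacobson radical (the intersection of all maximal ideals). $R$-algebras are associative and unital, not necessarily commutative. A left $H$-module $M$ is faithful if $hM=0$ with $h\in H$ implies $h=0$. $M/\mathfrak{m}M$ is a module over $H/\mathfrak{m}H$ via the induced action. *)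

theory Defs
  imports Complex_Main "HOL-Algebra.QuotRing" "HOL-Algebra.Generated_Groups"
    "Jordan_Normal_Form.Missing_VectorSpace"
begin

definition jacobson_radical :: "('a, 'k) ring_scheme \<Rightarrow> 'a set"
  where "jacobson_radical R = carrier R \<inter> \<Inter>{I. maximalideal I R}"

definition ring_char :: "('a, 'k) ring_scheme \<Rightarrow> nat"
  where "ring_char R =
    (if \<exists>n::nat. 0 < n \<and> add_pow R n \<one>\<^bsub>R\<^esub> = \<zero>\<^bsub>R\<^esub>
     then LEAST n::nat. 0 < n \<and> add_pow R n \<one>\<^bsub>R\<^esub> = \<zero>\<^bsub>R\<^esub> else 0)"


text \<open>The library locale \<^locale>\<open>algebra\<close> requires the algebra to be commutative, and
  \<^locale>\<open>module\<close> requires the scalar ring to be commutative; the following two locales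
  drop these requirements.\<close>

locale assoc_algebra = module R H + ring H for R and H (structure) +
  assumes smult_mult_left:
      "\<lbrakk>a \<in> carrier R; x \<in> carrier H; y \<in> carrier H\<rbrakk>
        \<Longrightarrow> (a \<odot> x) \<otimes> y = a \<odot> (x \<otimes> y)"
    and smult_mult_right:
      "\<lbrakk>a \<in> carrier R; x \<in> carrier H; y \<in> carrier H\<rbrakk>
        \<Longrightarrow> x \<otimes> (a \<odot> y) = a \<odot> (x \<otimes> y)"

locale left_module = H?: ring H + M?: abelian_group M
  for H :: "('h, 'k) ring_scheme" (structure)
    and M :: "('h, 'm, 'l) module_scheme" (structure) +
  assumes smult_closed:
      "\<lbrakk>a \<in> carrier H; x \<in> carrier M\<rbrakk> \<Longrightarrow> a \<odot>\<^bsub>M\<^esub> x \<in> carrier M"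
    and smult_l_distr:
      "\<lbrakk>a \<in> carrier H; b \<in> carrier H; x \<in> carrier M\<rbrakk>
        \<Longrightarrow> (a \<oplus> b) \<odot>\<^bsub>M\<^esub> x = a \<odot>\<^bsub>M\<^esub> x \<oplus>\<^bsub>M\<^esub> b \<odot>\<^bsub>M\<^esub> x"
    and smult_r_distr:
      "\<lbrakk>a \<in> carrier H; x \<in> carrier M; y \<in> carrier M\<rbrakk>
        \<Longrightarrow> a \<odot>\<^bsub>M\<^esub> (x \<oplus>\<^bsub>M\<^esub> y) = a \<odot>\<^bsub>M\<^esub> x \<oplus>\<^bsub>M\<^esub> a \<odot>\<^bsub>M\<^esub> y"
    and smult_assoc:
      "\<lbrakk>a \<in> carrier H; b \<in> carrier H; x \<in> carrier M\<rbrakk>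
        \<Longrightarrow> (a \<otimes> b) \<odot>\<^bsub>M\<^esub> x = a \<odot>\<^bsub>M\<^esub> (b \<odot>\<^bsub>M\<^esub> x)"
    and smult_one:
      "x \<in> carrier M \<Longrightarrow> \<one> \<odot>\<^bsub>M\<^esub> x = x"

locale faithful_module = left_module +
  assumes faithful:
    "\<lbrakk>h \<in> carrier H; \<And>x. x \<in> carrier M \<Longrightarrow> h \<odot>\<^bsub>M\<^esub> x = \<zero>\<^bsub>M\<^esub>\<rbrakk> \<Longrightarrow> h = \<zero>"

definition module_basis ::
    "('r, 'k) ring_scheme \<Rightarrow> ('r, 'm, 'l) module_scheme \<Rightarrow> 'm set \<Rightarrow> bool"
  where "module_basis R M B \<longleftrightarrow>
    module R M \<and> B \<subseteq> carrier M \<and> module.lin_indpt R M B \<and> module.span R M B = carrier M"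

definition free_module :: "('r, 'k) ring_scheme \<Rightarrow> ('r, 'm, 'l) module_scheme \<Rightarrow> bool"
  where "free_module R M \<longleftrightarrow> (\<exists>B. module_basis R M B)"

definition free_module_finite_rank ::
    "('r, 'k) ring_scheme \<Rightarrow> ('r, 'm, 'l) module_scheme \<Rightarrow> bool"
  where "free_module_finite_rank R M \<longleftrightarrow> (\<exists>B. finite B \<and> module_basis R M B)"


text \<open>A module over an \<open>R\<close>-algebra \<open>H\<close>, viewed as an \<open>R\<close>-module along the structure map
  \<open>r \<mapsto> r \<cdot> 1\<close> from \<open>R\<close> to \<open>H\<close>.\<close>

definition restrict_scalars ::
    "('r, 'h, 'k) module_scheme \<Rightarrow> ('h, 'm, 'l) module_scheme \<Rightarrow> ('r, 'm) module"
  where "restrict_scalars H M =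
    \<lparr>carrier = carrier M, mult = mult M, one = one M, zero = zero M, add = add M,
     smult = (\<lambda>r x. (r \<odot>\<^bsub>H\<^esub> \<one>\<^bsub>H\<^esub>) \<odot>\<^bsub>M\<^esub> x)\<rparr>"

definition ideal_smult :: "'r set \<Rightarrow> ('r, 'm, 'k) module_scheme \<Rightarrow> 'm set"
  where "ideal_smult I M = generate (add_monoid M) {a \<odot>\<^bsub>M\<^esub> x | a x. a \<in> I \<and> x \<in> carrier M}"

text \<open>As for \<^const>\<open>rcoset_mult\<close>, operations on cosets are unions over all representatives.\<close>

definition FactAlgebra :: "('r, 'h, 'k) module_scheme \<Rightarrow> 'h set \<Rightarrow> ('r, 'h set) module"
  where "FactAlgebra H J =
    ring.extend (H Quot J) (module.fields (\<lambda>r A. \<Union>h\<in>A. J +>\<^bsub>H\<^esub> (r \<odot>\<^bsub>H\<^esub> h)))"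

text \<open>The quotient of an \<open>H\<close>-module \<open>M\<close> by \<open>N\<close>, with scalars the cosets of an ideal \<open>J\<close> of \<open>H\<close>.
  The action is well defined when \<open>J M \<subseteq> N\<close>. The multiplicative fields play no role in a module.\<close>

definition FactModule :: "('h, 'm, 'k) module_scheme \<Rightarrow> 'm set \<Rightarrow> ('h set, 'm set) module"
  where "FactModule M N =
    \<lparr>carrier = a_rcosets\<^bsub>M\<^esub> N, mult = undefined, one = undefined, zero = N, add = set_add M,
     smult = (\<lambda>A X. \<Union>h\<in>A. \<Union>x\<in>X. N +>\<^bsub>M\<^esub> (h \<odot>\<^bsub>M\<^esub> x))\<rparr>"

definition product_algebra ::
    "'i set \<Rightarrow> ('i \<Rightarrow> ('r, 'h, 'k) module_scheme) \<Rightarrow> ('r, 'i \<Rightarrow> 'h) module"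
  where "product_algebra I A =
    \<lparr>carrier = (\<Pi>\<^sub>E i\<in>I. carrier (A i)),
     mult = (\<lambda>f g. \<lambda>i\<in>I. f i \<otimes>\<^bsub>A i\<^esub> g i),
     one = (\<lambda>i\<in>I. \<one>\<^bsub>A i\<^esub>),
     zero = (\<lambda>i\<in>I. \<zero>\<^bsub>A i\<^esub>),
     add = (\<lambda>f g. \<lambda>i\<in>I. f i \<oplus>\<^bsub>A i\<^esub> g i),
     smult = (\<lambda>r f. \<lambda>i\<in>I. r \<odot>\<^bsub>A i\<^esub> f i)\<rparr>"

definition algebra_hom ::
    "('r, 'k) ring_scheme \<Rightarrow> ('r, 'a, 'l) module_scheme \<Rightarrow> ('r, 'b, 'n) module_scheme \<Rightarrow>
     ('a \<Rightarrow> 'b) set"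
  where "algebra_hom R A B = {f \<in> ring_hom A B.
    \<forall>r\<in>carrier R. \<forall>x\<in>carrier A. f (r \<odot>\<^bsub>A\<^esub> x) = r \<odot>\<^bsub>B\<^esub> f x}"

definition canonical_hom :: "('r, 'h, 'k) module_scheme \<Rightarrow> 'r set set \<Rightarrow> 'h \<Rightarrow> 'r set \<Rightarrow> 'h set"
  where "canonical_hom H Y h = (\<lambda>\<mm>\<in>Y. ideal_smult \<mm> H +>\<^bsub>H\<^esub> h)"

end

theory Submission
  imports Defs
begin

text \<open>
  Fix an \<open>R\<close>-basis of \<open>H\<close> and one of \<open>M\<close>. Faithfulness of \<open>M\<close> says that the matrix entries of
  the action, regarded as linear forms in the finitely many coordinates \<open>r\<^sub>b\<close> of an element of \<open>H\<close>,
  have no common nonzero solution. Fraction-free Gaussian elimination then yields a single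
  \<open>d \<noteq> 0\<close> in \<open>R\<close> such that these forms still have no common nonzero solution modulo any prime
  that avoids \<open>d\<close>. With \<open>N = \<lfloor>q\<rfloor>\<close>, take \<open>Y\<close> to be the maximal ideals that do not contain
  \<open>d \<cdot> N!\<close>. They have residue characteristic above \<open>q\<close>, and their intersection is zero because
  \<open>d \<cdot> N!\<close> times any element of it lies in the Jacobson radical.
\<close>

subsection \<open>Fraction-free elimination\<close>

text \<open>Induction on the number of unknowns. A form \<open>a\<close> with nonzero pivot
  \<open>a x\<close> eliminates \<open>x\<close> from all other forms by cross-multiplication, and
  the \<open>d\<close> of the smaller system is multiplied by that pivot. Only one pivot per unknown
  is ever chosen, so a single \<open>d\<close> serves all primes even when \<open>F\<close> is
  infinite.\<close>

lemma (in domain) uniform_elimination: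
  assumes "finite B" and "F \<subseteq> B \<rightarrow> carrier R"
    and "\<And>r. r \<in> B \<rightarrow> carrier R \<Longrightarrow> (\<And>a. a \<in> F \<Longrightarrow> (\<Oplus>i\<in>B. a i \<otimes> r i) = \<zero>)
        \<Longrightarrow> \<forall>i\<in>B. r i = \<zero>"
  shows "\<exists>d\<in>carrier R. d \<noteq> \<zero> \<and>
    (\<forall>P r. primeideal P R \<longrightarrow> d \<notin> P \<longrightarrow> r \<in> B \<rightarrow> carrier R \<longrightarrow>
      (\<forall>a\<in>F. (\<Oplus>i\<in>B. a i \<otimes> r i) \<in> P) \<longrightarrow> (\<forall>i\<in>B. r i \<in> P))"
  using assms
proof (induction B arbitrary: F rule: finite_induct)
  case empty
  show ?case by (intro bexI[of _ \<one>]) auto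
next
  case (insert x B F)
  have split: "(\<Oplus>i\<in>insert x B. a i \<otimes> r i) = a x \<otimes> r x \<oplus> (\<Oplus>i\<in>B. a i \<otimes> r i)"
    if "a \<in> insert x B \<rightarrow> carrier R" "r \<in> insert x B \<rightarrow> carrier R" for a r
    using that insert.hyps by (intro finsum_insert) (auto simp: Pi_def)
  have "\<exists>a\<in>F. a x \<noteq> \<zero>"
  proof (rule ccontr)
    assume no: "\<not> (\<exists>a\<in>F. a x \<noteq> \<zero>)"
    \<comment> \<open>If every form ignored \<open>x\<close>, this unit vector would be a nonzero
      common solution.\<close>
    define r where "r i = (if i = x then \<one> else \<zero>)" for i
    have r: "r \<in> insert x B \<rightarrow> carrier R" by (auto simp: r_def)
    have "(\<Oplus>i\<in>insert x B. a i \<otimes> r i) = \<zero>" if "a \<in> F" for a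
    proof -
      have a: "a \<in> insert x B \<rightarrow> carrier R" using that insert.prems(1) by auto
      have "(\<Oplus>i\<in>B. a i \<otimes> r i) = (\<Oplus>i\<in>B. \<zero>)"
        using a insert.hyps by (intro finsum_cong') (auto simp: r_def Pi_def)
      moreover have "a x = \<zero>" using no that by blast
      ultimately show ?thesis using r by (simp add: split[OF a r])
    qed
    then have "r x = \<zero>" using insert.prems(2)[OF r] by blast
    then show False by (simp add: r_def)
  qed
  then obtain a where a: "a \<in> F" "a x \<noteq> \<zero>" by blast
  have aB: "a \<in> insert x B \<rightarrow> carrier R" using a insert.prems(1) by auto
  have ax: "a x \<in> carrier R" using aB by auto
  \<comment> \<open>At \<open>i = x\<close> this combination cancels, so \<open>red b\<close> is a
    form in the unknowns \<open>B\<close> alone. No division occurs, so no inverse of the pivot is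
    required.\<close>
  define red where "red b = (\<lambda>i. a x \<otimes> b i \<ominus> b x \<otimes> a i)" for b
  have red_sum: "(\<Oplus>i\<in>B. red b i \<otimes> r i) =
      a x \<otimes> (\<Oplus>i\<in>B. b i \<otimes> r i) \<ominus> b x \<otimes> (\<Oplus>i\<in>B. a i \<otimes> r i)"
    if b: "b \<in> insert x B \<rightarrow> carrier R" and r: "r \<in> B \<rightarrow> carrier R" for b r
  proof -
    have "(\<Oplus>i\<in>B. red b i \<otimes> r i) =
      (\<Oplus>i\<in>B. a x \<otimes> (b i \<otimes> r i) \<oplus> (\<ominus> b x) \<otimes> (a i \<otimes> r i))"
    proof (intro finsum_cong')
      fix i assume i: "i \<in> B"
      have c: "a i \<in> carrier R" "b i \<in> carrier R" "b x \<in> carrier R" "r i \<in> carrier R"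
        using i aB b r by auto
      show "red b i \<otimes> r i = a x \<otimes> (b i \<otimes> r i) \<oplus> (\<ominus> b x) \<otimes> (a i \<otimes> r i)"
        unfolding red_def using c ax by algebra
    qed (use aB b r ax in \<open>auto simp: Pi_def\<close>)
    also have "\<dots> = (\<Oplus>i\<in>B. a x \<otimes> (b i \<otimes> r i)) \<oplus> (\<Oplus>i\<in>B. (\<ominus> b x) \<otimes> (a i \<otimes> r i))"
      using aB b r by (intro finsum_addf) (auto simp: Pi_def)
    also have "\<dots> = a x \<otimes> (\<Oplus>i\<in>B. b i \<otimes> r i) \<oplus> (\<ominus> b x) \<otimes> (\<Oplus>i\<in>B. a i \<otimes> r i)"
      using aB b r insert.hyps by (subst (1 2) finsum_rdistr) (auto simp: Pi_def)
    also have "\<dots> = a x \<otimes> (\<Oplus>i\<in>B. b i \<otimes> r i) \<ominus> b x \<otimes> (\<Oplus>i\<in>B. a i \<otimes> r i)"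
    proof -
      have "(\<Oplus>i\<in>B. a i \<otimes> r i) \<in> carrier R" using aB r by (intro finsum_closed) (auto simp: Pi_def)
      then show ?thesis using b by (simp add: minus_eq l_minus Pi_def)
    qed
    finally show ?thesis .
  qed
  have red_closed: "red ` F \<subseteq> B \<rightarrow> carrier R"
    using insert.prems(1) aB by (fastforce simp: red_def)
  have red_inj: "\<forall>i\<in>B. r i = \<zero>"
    if r: "r \<in> B \<rightarrow> carrier R" and 0: "\<And>b. b \<in> red ` F \<Longrightarrow> (\<Oplus>i\<in>B. b i \<otimes> r i) = \<zero>" for r
  proof -
    define s where "s = (\<Oplus>i\<in>B. a i \<otimes> r i)"
    have s: "s \<in> carrier R" unfolding s_def using aB r by (intro finsum_closed) (auto simp: Pi_def)
    \<comment> \<open>A solution of the reduced system lifts to the full one after scaling by the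
      pivot. The value at \<open>x\<close> makes the form \<open>a\<close> vanish, and the form
      \<open>b\<close> then takes the value of \<open>red b\<close> at \<open>r\<close>, which is
      zero.\<close>
    define r' where "r' i = (if i = x then \<ominus> s else a x \<otimes> r i)" for i
    have r': "r' \<in> insert x B \<rightarrow> carrier R" using r s ax by (auto simp: r'_def Pi_def)
    have r'_at: "r' x = \<ominus> s" by (simp add: r'_def)
    have "(\<Oplus>i\<in>insert x B. b i \<otimes> r' i) = \<zero>" if "b \<in> F" for b
    proof -
      have b: "b \<in> insert x B \<rightarrow> carrier R" using that insert.prems(1) by auto
      define t where "t = (\<Oplus>i\<in>B. b i \<otimes> r i)"
      have t: "t \<in> carrier R" unfolding t_def using b r by (intro finsum_closed) (auto simp: Pi_def)
      have bx: "b x \<in> carrier R" using b by auto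
      have "(\<Oplus>i\<in>B. b i \<otimes> r' i) = (\<Oplus>i\<in>B. a x \<otimes> (b i \<otimes> r i))"
        using b r ax insert.hyps
        by (intro finsum_cong') (auto simp: r'_def Pi_def m_lcomm)
      also have "\<dots> = a x \<otimes> t"
        unfolding t_def using b r ax insert.hyps by (subst finsum_rdistr) (auto simp: Pi_def)
      finally have "(\<Oplus>i\<in>insert x B. b i \<otimes> r' i) = b x \<otimes> (\<ominus> s) \<oplus> a x \<otimes> t"
        by (simp add: split[OF b r'] r'_at)
      also have "\<dots> = a x \<otimes> t \<ominus> b x \<otimes> s" using bx s t ax by algebra
      also have "\<dots> = \<zero>"
        using 0[of "red b"] that red_sum[OF b r] by (simp add: s_def t_def)
      finally show ?thesis .
    qed
    then have "\<forall>i\<in>insert x B. r' i = \<zero>" using insert.prems(2)[OF r'] by blast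
    then have "a x \<otimes> r i = \<zero>" if "i \<in> B" for i
      using that insert.hyps(2) by (metis insertI2 r'_def)
    then show ?thesis using integral a(2) ax r by blast
  qed
  obtain d where d: "d \<in> carrier R" "d \<noteq> \<zero>"
    and dP: "\<And>P r. \<lbrakk>primeideal P R; d \<notin> P; r \<in> B \<rightarrow> carrier R;
      \<forall>b\<in>red ` F. (\<Oplus>i\<in>B. b i \<otimes> r i) \<in> P\<rbrakk> \<Longrightarrow> \<forall>i\<in>B. r i \<in> P"
    using insert.IH[OF red_closed red_inj] by blast
  show ?case
  \<comment> \<open>An ideal avoiding the product avoids both factors: \<open>d\<close> for the
    induction hypothesis, \<open>a x\<close> for the last unknown.\<close>
  proof (intro bexI[of _ "d \<otimes> a x"] conjI allI impI)
    show "d \<otimes> a x \<in> carrier R" "d \<otimes> a x \<noteq> \<zero>" using d ax a(2) by (auto simp: integral_iff)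
    fix P r
    assume P: "primeideal P R" and dax: "d \<otimes> a x \<notin> P" and r: "r \<in> insert x B \<rightarrow> carrier R"
      and F: "\<forall>a\<in>F. (\<Oplus>i\<in>insert x B. a i \<otimes> r i) \<in> P"
    interpret P: primeideal P R by fact
    have dnP: "d \<notin> P" "a x \<notin> P" using dax d ax P.I_l_closed P.I_r_closed by auto
    have rB: "r \<in> B \<rightarrow> carrier R" and rx: "r x \<in> carrier R" using r by auto
    define s where "s = (\<Oplus>i\<in>B. a i \<otimes> r i)"
    have s: "s \<in> carrier R" unfolding s_def using aB r by (intro finsum_closed) (auto simp: Pi_def)
    have aP: "a x \<otimes> r x \<oplus> s \<in> P" using bspec[OF F a(1)] unfolding split[OF aB r] s_def .
    have rP: "\<forall>i\<in>B. r i \<in> P"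
    proof (rule dP[OF P dnP(1) rB], clarify)
      fix b assume "b \<in> F"
      then have b: "b \<in> insert x B \<rightarrow> carrier R" using insert.prems(1) by auto
      define t where "t = (\<Oplus>i\<in>B. b i \<otimes> r i)"
      have t: "t \<in> carrier R" unfolding t_def using b r by (intro finsum_closed) (auto simp: Pi_def)
      have bx: "b x \<in> carrier R" using b by auto
      have bP: "b x \<otimes> r x \<oplus> t \<in> P" using bspec[OF F \<open>b \<in> F\<close>] unfolding split[OF b r] t_def .
      have "(\<Oplus>i\<in>B. red b i \<otimes> r i) = a x \<otimes> t \<ominus> b x \<otimes> s"
        using red_sum[OF b rB] by (simp add: s_def t_def)
      \<comment> \<open>The \<open>r x\<close> terms cancel, which exhibits the reduced form as a
        combination of the values of the forms \<open>b\<close> and \<open>a\<close>, both in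
        \<open>P\<close>.\<close>
      also have "\<dots> = a x \<otimes> (b x \<otimes> r x \<oplus> t) \<oplus> \<ominus> (b x \<otimes> (a x \<otimes> r x \<oplus> s))"
        using ax bx rx s t by algebra
      also have "\<dots> \<in> P"
        using P.I_l_closed[OF bP ax] P.I_l_closed[OF aP bx] by blast
      finally show "(\<Oplus>i\<in>B. red b i \<otimes> r i) \<in> P" .
    qed
    \<comment> \<open>With all other unknowns in \<open>P\<close>, so is the tail \<open>s\<close>
      of the form \<open>a\<close>. This leaves \<open>a x\<close> times \<open>r x\<close> in
      \<open>P\<close>, and primality gives \<open>r x\<close> in \<open>P\<close>. The induction
      runs over subsets of \<open>B\<close> so that the coefficients stay in the carrier.\<close>
    have "s \<in> P" unfolding s_def using \<open>finite B\<close> rP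
    proof (rule_tac finite_induct[OF \<open>finite B\<close>, of "\<lambda>A. A \<subseteq> B \<longrightarrow> (\<Oplus>i\<in>A. a i \<otimes> r i) \<in> P", THEN mp])
      fix j A assume j: "finite A" "j \<notin> A" "A \<subseteq> B \<longrightarrow> (\<Oplus>i\<in>A. a i \<otimes> r i) \<in> P"
      show "insert j A \<subseteq> B \<longrightarrow> (\<Oplus>i\<in>insert j A. a i \<otimes> r i) \<in> P"
      proof
        assume jB: "insert j A \<subseteq> B"
        then have "(\<Oplus>i\<in>insert j A. a i \<otimes> r i) = a j \<otimes> r j \<oplus> (\<Oplus>i\<in>A. a i \<otimes> r i)"
          using j aB r by (intro finsum_insert) (auto simp: Pi_def)
        moreover have "a j \<otimes> r j \<in> P" using rP jB aB by (intro P.I_l_closed) auto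
        ultimately show "(\<Oplus>i\<in>insert j A. a i \<otimes> r i) \<in> P" using j jB by auto
      qed
    qed auto
    then have "(a x \<otimes> r x \<oplus> s) \<oplus> \<ominus> s \<in> P" using aP by blast
    moreover have "(a x \<otimes> r x \<oplus> s) \<oplus> \<ominus> s = a x \<otimes> r x" using s ax rx by algebra
    ultimately have "r x \<in> P" using P.I_prime[OF ax rx] dnP by auto
    then show "\<forall>i\<in>insert x B. r i \<in> P" using rP by blast
  qed
qed

subsection \<open>Coordinates with respect to a basis\<close>

text \<open>Allows coordinate functions with different finite supports to be compared on a common
  one.\<close>

lemma (in module) lincomb_extend_zero:
  assumes "finite A" "finite A'" "A \<subseteq> A'" "A' \<subseteq> carrier M" "f \<in> A' \<rightarrow> carrier R"
    and "\<And>b. b \<in> A' - A \<Longrightarrow> f b = \<zero>\<^bsub>R\<^esub>"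
  shows "lincomb f A' = lincomb f A"
  unfolding lincomb_def
proof (rule M.add.finprod_mono_neutral_cong_right)
  show "f i \<odot>\<^bsub>M\<^esub> i = \<zero>\<^bsub>M\<^esub>" if "i \<in> A' - A" for i
    using that assms by auto
qed (use assms in \<open>auto simp: Pi_def\<close>)

text \<open>The basis may be infinite, hence the finite set \<open>A\<close> that contains the
  support. Values of \<open>f\<close> off \<open>B\<close> are unconstrained, so uniqueness can only
  be claimed on \<open>B\<close>.\<close>

definition is_coords ::
    "('r, 'k) ring_scheme \<Rightarrow> ('r, 'm, 'l) module_scheme \<Rightarrow> 'm set \<Rightarrow> 'm \<Rightarrow> ('m \<Rightarrow> 'r) \<Rightarrow> bool"
  where "is_coords R M B x f \<longleftrightarrow> f \<in> B \<rightarrow> carrier R \<and>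
    (\<exists>A. finite A \<and> A \<subseteq> B \<and> (\<forall>b\<in>B - A. f b = \<zero>\<^bsub>R\<^esub>) \<and> x = module.lincomb M f A)"

definition coord ::
    "('r, 'k) ring_scheme \<Rightarrow> ('r, 'm, 'l) module_scheme \<Rightarrow> 'm set \<Rightarrow> 'm \<Rightarrow> 'm \<Rightarrow> 'r"
  where "coord R M B x = (SOME f. is_coords R M B x f)"

text \<open>Instantiated twice below: for \<open>H\<close>, and for the module with scalars
  restricted to \<open>R\<close>.\<close>

locale based_module = module R M for R and M (structure) +
  fixes B
  assumes basis: "module_basis R M B"
begin

lemma basis_closed: "B \<subseteq> carrier M"
  and basis_indpt: "lin_indpt B"
  and basis_span: "span B = carrier M"
  using basis by (auto simp: module_basis_def)

lemma is_coords_add: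
  assumes "is_coords R M B x f" "is_coords R M B y g"
  shows "is_coords R M B (x \<oplus> y) (\<lambda>b. f b \<oplus>\<^bsub>R\<^esub> g b)"
proof -
  from assms obtain A A' where A: "finite A" "A \<subseteq> B" "\<forall>b\<in>B - A. f b = \<zero>\<^bsub>R\<^esub>" "x = lincomb f A"
    and A': "finite A'" "A' \<subseteq> B" "\<forall>b\<in>B - A'. g b = \<zero>\<^bsub>R\<^esub>" "y = lincomb g A'"
    and fg: "f \<in> B \<rightarrow> carrier R" "g \<in> B \<rightarrow> carrier R"
    unfolding is_coords_def by blast
  let ?C = "A \<union> A'"
  have C: "finite ?C" "?C \<subseteq> carrier M" "f \<in> ?C \<rightarrow> carrier R" "g \<in> ?C \<rightarrow> carrier R"
    using A A' fg basis_closed by auto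
  have "lincomb f ?C = x" "lincomb g ?C = y"
    using lincomb_extend_zero[of A ?C f] lincomb_extend_zero[of A' ?C g] A A' C by auto
  then have "x \<oplus> y = lincomb (\<lambda>b. f b \<oplus>\<^bsub>R\<^esub> g b) ?C"
    using lincomb_sum C by simp
  then show ?thesis
    unfolding is_coords_def using A A' C fg
    by (intro conjI exI[of _ ?C]) (auto simp: Pi_def)
qed

lemma is_coords_smult:
  assumes "is_coords R M B x f" "r \<in> carrier R"
  shows "is_coords R M B (r \<odot> x) (\<lambda>b. r \<otimes>\<^bsub>R\<^esub> f b)"
proof -
  from assms obtain A where A: "finite A" "A \<subseteq> B" "\<forall>b\<in>B - A. f b = \<zero>\<^bsub>R\<^esub>" "x = lincomb f A"
    and f: "f \<in> B \<rightarrow> carrier R"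
    unfolding is_coords_def by blast
  have "lincomb (\<lambda>b. r \<otimes>\<^bsub>R\<^esub> f b) A = r \<odot> x"
    using A f assms(2) basis_closed by (subst lincomb_smult) auto
  then show ?thesis
    unfolding is_coords_def using A f assms(2)
    by (intro conjI exI[of _ A]) (auto simp: Pi_def)
qed

text \<open>A nonzero coordinate would lie in the finite support and turn the representation of zero
  into a linear dependence.\<close>

lemma is_coords_zero:
  assumes "is_coords R M B \<zero> f" "b \<in> B"
  shows "f b = \<zero>\<^bsub>R\<^esub>"
proof (rule ccontr)
  assume nz: "f b \<noteq> \<zero>\<^bsub>R\<^esub>"
  from assms obtain A where A: "finite A" "A \<subseteq> B" "\<forall>b\<in>B - A. f b = \<zero>\<^bsub>R\<^esub>" "\<zero> = lincomb f A"
    and f: "f \<in> B \<rightarrow> carrier R"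
    unfolding is_coords_def by blast
  have "b \<in> A" using nz A assms(2) by blast
  moreover have "f \<in> A \<rightarrow> carrier R" using f A by auto
  ultimately have "lin_dep B" using A(1,2,4) nz by (intro lin_dep_crit[of A B f b]) auto
  then show False using basis_indpt by blast
qed

lemma is_coords_unique:
  assumes "is_coords R M B x f" "is_coords R M B x g" "x \<in> carrier M" "b \<in> B"
  shows "f b = g b"
proof -
  \<comment> \<open>The difference of the two representations represents zero. Writing it with the
    scalar minus one makes the sum and scalar rules applicable.\<close>
  have "is_coords R M B (x \<oplus> (\<ominus>\<^bsub>R\<^esub> \<one>\<^bsub>R\<^esub>) \<odot> x) (\<lambda>b. f b \<oplus>\<^bsub>R\<^esub> (\<ominus>\<^bsub>R\<^esub> \<one>\<^bsub>R\<^esub>) \<otimes>\<^bsub>R\<^esub> g b)"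
    using assms by (intro is_coords_add is_coords_smult) auto
  moreover have "x \<oplus> (\<ominus>\<^bsub>R\<^esub> \<one>\<^bsub>R\<^esub>) \<odot> x = \<zero>"
    using assms(3) by (simp add: smult_l_minus M.r_neg)
  ultimately have "f b \<oplus>\<^bsub>R\<^esub> (\<ominus>\<^bsub>R\<^esub> \<one>\<^bsub>R\<^esub>) \<otimes>\<^bsub>R\<^esub> g b = \<zero>\<^bsub>R\<^esub>"
    using is_coords_zero assms(4) by simp
  moreover have "f b \<in> carrier R" "g b \<in> carrier R"
    using assms unfolding is_coords_def by auto
  ultimately show ?thesis
    by (metis R.l_minus R.l_one R.minus_closed R.minus_equality R.minus_minus R.one_closed R.a_inv_closed)
qed

lemma is_coords_coord:
  assumes "x \<in> carrier M"
  shows "is_coords R M B x (coord R M B x)"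
proof -
  from assms obtain a A where A: "finite A" "A \<subseteq> B" "a \<in> A \<rightarrow> carrier R" "x = lincomb a A"
    unfolding basis_span[symmetric] span_def by blast
  \<comment> \<open>The span provides coefficients on \<open>A\<close> only, while coordinates must
    vanish on the rest of \<open>B\<close>.\<close>
  let ?f = "\<lambda>b. if b \<in> A then a b else \<zero>\<^bsub>R\<^esub>"
  have "lincomb ?f A = x"
    unfolding A(4) using A basis_closed by (intro lincomb_cong) auto
  then have "is_coords R M B x ?f"
    unfolding is_coords_def using A by (intro conjI exI[of _ A]) (auto simp: Pi_def)
  then show ?thesis unfolding coord_def by (rule someI[of "is_coords R M B x"])
qed

lemma coord_eqI:
  assumes "is_coords R M B x f" "x \<in> carrier M" "b \<in> B"
  shows "coord R M B x b = f b"
  using is_coords_unique[OF is_coords_coord] assms by blast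

lemma coord_closed: "\<lbrakk>x \<in> carrier M; b \<in> B\<rbrakk> \<Longrightarrow> coord R M B x b \<in> carrier R"
  using is_coords_coord unfolding is_coords_def by blast

lemma coord_add:
  "\<lbrakk>x \<in> carrier M; y \<in> carrier M; b \<in> B\<rbrakk> \<Longrightarrow>
    coord R M B (x \<oplus> y) b = coord R M B x b \<oplus>\<^bsub>R\<^esub> coord R M B y b"
  by (rule coord_eqI[OF is_coords_add[OF is_coords_coord is_coords_coord]]) auto

lemma coord_smult:
  "\<lbrakk>r \<in> carrier R; x \<in> carrier M; b \<in> B\<rbrakk> \<Longrightarrow>
    coord R M B (r \<odot> x) b = r \<otimes>\<^bsub>R\<^esub> coord R M B x b"
  by (rule coord_eqI[OF is_coords_smult[OF is_coords_coord]]) auto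

lemma coord_zero: "b \<in> B \<Longrightarrow> coord R M B \<zero> b = \<zero>\<^bsub>R\<^esub>"
  using is_coords_zero is_coords_coord by blast

lemma coord_finsum:
  assumes "finite A" "g \<in> A \<rightarrow> carrier M" "b \<in> B"
  shows "coord R M B (\<Oplus>i\<in>A. g i) b = (\<Oplus>\<^bsub>R\<^esub>i\<in>A. coord R M B (g i) b)"
  using assms
proof (induction A rule: finite_induct)
  case (insert i A)
  then have g: "g i \<in> carrier M" "g \<in> A \<rightarrow> carrier M" by auto
  have "coord R M B (\<Oplus>i\<in>insert i A. g i) b = coord R M B (g i \<oplus> (\<Oplus>i\<in>A. g i)) b"
    using insert g by (subst M.finsum_insert) auto
  also have "\<dots> = coord R M B (g i) b \<oplus>\<^bsub>R\<^esub> (\<Oplus>\<^bsub>R\<^esub>i\<in>A. coord R M B (g i) b)"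
    using insert g by (subst coord_add) auto
  also have "\<dots> = (\<Oplus>\<^bsub>R\<^esub>i\<in>insert i A. coord R M B (g i) b)"
    using insert g by (subst R.finsum_insert) (auto intro!: coord_closed simp: Pi_def)
  finally show ?case .
qed (simp add: coord_zero)

lemma coord_all_zero:
  assumes "x \<in> carrier M" "\<And>b. b \<in> B \<Longrightarrow> coord R M B x b = \<zero>\<^bsub>R\<^esub>"
  shows "x = \<zero>"
proof -
  from is_coords_coord[OF assms(1)] obtain A where A: "A \<subseteq> B" "x = lincomb (coord R M B x) A"
    unfolding is_coords_def by blast
  moreover have "lincomb (coord R M B x) A = \<zero>"
    unfolding lincomb_def using A(1) assms basis_closed by (intro M.add.finprod_one_eqI) (metis lmult_0 subsetD)
  ultimately show ?thesis by simp
qed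

lemma coord_expansion:
  assumes "finite B" "x \<in> carrier M"
  shows "x = lincomb (coord R M B x) B"
proof -
  from is_coords_coord[OF assms(2)] obtain A where A: "finite A" "A \<subseteq> B"
      "\<forall>b\<in>B - A. coord R M B x b = \<zero>\<^bsub>R\<^esub>" "x = lincomb (coord R M B x) A"
    and f: "coord R M B x \<in> B \<rightarrow> carrier R"
    unfolding is_coords_def by blast
  then show ?thesis
    using lincomb_extend_zero[of A B] assms basis_closed by simp
qed

lemma coord_lincomb:
  assumes "finite B" "f \<in> B \<rightarrow> carrier R" "b \<in> B"
  shows "coord R M B (lincomb f B) b = f b"
proof (rule coord_eqI)
  show "is_coords R M B (lincomb f B) f"
    unfolding is_coords_def using assms by (intro conjI exI[of _ B]) auto
qed (use assms basis_closed in auto)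

end

subsection \<open>Quotients of algebras and modules\<close>

lemma (in module) ideal_smult_subgroup:
  assumes "I \<subseteq> carrier R"
  shows "additive_subgroup (ideal_smult I M) M"
  unfolding ideal_smult_def using assms
  by (intro additive_subgroupI group.generate_is_subgroup) (auto intro: M.a_group)

text \<open>A linear map sends each generator \<open>a x\<close> to \<open>a\<close> times the image
  of \<open>x\<close>. All closure properties of \<open>IM\<close> below are instances, for
  multiplications in \<open>H\<close>, for scalars, and for the action on \<open>M\<close>.\<close>

lemma ideal_smult_image:
  assumes "mod_hom R M N f" "I \<subseteq> carrier R" "x \<in> ideal_smult I M"
  shows "f x \<in> ideal_smult I N"
proof -
  interpret mod_hom R M N f by fact
  interpret N: additive_subgroup "ideal_smult I N" N
    using assms(2) by (rule N.ideal_smult_subgroup)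
  have gen: "f (a \<odot>\<^bsub>M\<^esub> x) \<in> ideal_smult I N" "a \<odot>\<^bsub>M\<^esub> x \<in> carrier M"
    if "a \<in> I" "x \<in> carrier M" for a x
    using that assms(2) f_smult[of a x]
    by (auto simp: ideal_smult_def subset_iff intro!: generate.incl)
  \<comment> \<open>Membership in the carrier is carried through the induction because
    \<open>f\<close> is additive only there.\<close>
  have "x \<in> carrier M \<and> f x \<in> ideal_smult I N"
    using assms(3) unfolding ideal_smult_def[of I M]
  proof (induction rule: generate.induct)
    case (inv h)
    then show ?case
      using gen f_neg by (auto simp flip: a_inv_def)
  next
    case (eng h1 h2)
    then show ?case using f_add by auto
  qed (use gen in auto)
  then show ?thesis by blast
qed

text \<open>Coordinates are linear, so those of a generator \<open>a x\<close> are multiples of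
  \<open>a\<close>. No finiteness of the basis enters, so this applies to \<open>M\<close>.\<close>

lemma (in based_module) coord_mem_of_ideal_smult:
  assumes "ideal I R" "x \<in> ideal_smult I M" "b \<in> B"
  shows "coord R M B x b \<in> I"
proof -
  interpret I: ideal I R by fact
  have gen: "coord R M B (a \<odot> x) b \<in> I" "a \<odot> x \<in> carrier M"
    if "a \<in> I" "x \<in> carrier M" for a x
    using that assms(3) by (auto simp: coord_smult coord_closed I.I_r_closed)
  have neg: "coord R M B (\<ominus> x) b = \<ominus>\<^bsub>R\<^esub> coord R M B x b" if "x \<in> carrier M" for x
  proof -
    have "coord R M B (\<ominus> x) b \<oplus>\<^bsub>R\<^esub> coord R M B x b = \<zero>\<^bsub>R\<^esub>"
      using that assms(3) by (simp add: M.l_neg coord_zero flip: coord_add)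
    then show ?thesis using that assms(3) by (simp add: R.minus_equality coord_closed)
  qed
  have "x \<in> carrier M \<and> coord R M B x b \<in> I"
    using assms(2) unfolding ideal_smult_def
  proof (induction rule: generate.induct)
    case (inv h)
    then show ?case
      using gen neg by (auto simp flip: a_inv_def)
  next
    case (eng h1 h2)
    then show ?case using assms(3) by (auto simp: coord_add)
  qed (use gen assms(3) in \<open>auto simp: coord_zero\<close>)
  then show ?thesis by blast
qed

text \<open>The expansion over the finite basis is a sum of generators of \<open>IM\<close>. This
  converse is applied to \<open>H\<close>.\<close>

lemma (in based_module) ideal_smult_of_coord_mem:
  assumes "ideal I R" "finite B" "x \<in> carrier M" "\<And>b. b \<in> B \<Longrightarrow> coord R M B x b \<in> I"
  shows "x \<in> ideal_smult I M"
proof -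
  interpret I: ideal I R by fact
  interpret S: additive_subgroup "ideal_smult I M" M
    using I.a_subset by (rule ideal_smult_subgroup)
  have mem: "coord R M B x b \<odot> b \<in> ideal_smult I M" if "b \<in> B" for b
    using that assms(4) basis_closed unfolding ideal_smult_def by (blast intro: generate.incl)
  have "(\<Oplus>b\<in>A. coord R M B x b \<odot> b) \<in> ideal_smult I M" if "finite A" "A \<subseteq> B" for A
    using that
  proof (induction A rule: finite_induct)
    case (insert b A)
    then have "(\<Oplus>b\<in>insert b A. coord R M B x b \<odot> b) =
        coord R M B x b \<odot> b \<oplus> (\<Oplus>b\<in>A. coord R M B x b \<odot> b)"
      using mem S.a_subset by (intro M.finsum_insert) auto
    then show ?case using insert mem by auto
  qed auto
  then show ?thesis
    using coord_expansion[OF assms(2,3)] assms(2) unfolding lincomb_def by force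
qed

lemma restrict_scalars_simps [simp]:
  "carrier (restrict_scalars H M) = carrier M"
  "zero (restrict_scalars H M) = zero M"
  "add (restrict_scalars H M) = add M"
  "smult (restrict_scalars H M) = (\<lambda>r x. (r \<odot>\<^bsub>H\<^esub> \<one>\<^bsub>H\<^esub>) \<odot>\<^bsub>M\<^esub> x)"
  by (simp_all add: restrict_scalars_def)

lemma a_inv_restrict_scalars [simp]: "a_inv (restrict_scalars H M) = a_inv M"
  by (simp add: fun_eq_iff a_inv_def m_inv_def)

section \<open>Ring and module structure on cosets\<close>

lemma FactAlgebra_simps [simp]:
  "carrier (FactAlgebra H J) = a_rcosets\<^bsub>H\<^esub> J"
  "mult (FactAlgebra H J) = rcoset_mult H J"
  "one (FactAlgebra H J) = J +>\<^bsub>H\<^esub> \<one>\<^bsub>H\<^esub>"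
  "zero (FactAlgebra H J) = J"
  "add (FactAlgebra H J) = set_add H"
  "smult (FactAlgebra H J) = (\<lambda>r A. \<Union>h\<in>A. J +>\<^bsub>H\<^esub> (r \<odot>\<^bsub>H\<^esub> h))"
  by (simp_all add: FactAlgebra_def FactRing_def ring.defs module.defs)

lemma FactModule_simps [simp]:
  "carrier (FactModule M N) = a_rcosets\<^bsub>M\<^esub> N"
  "zero (FactModule M N) = N"
  "add (FactModule M N) = set_add M"
  "smult (FactModule M N) = (\<lambda>A X. \<Union>h\<in>A. \<Union>x\<in>X. N +>\<^bsub>M\<^esub> (h \<odot>\<^bsub>M\<^esub> x))"
  by (simp_all add: FactModule_def)

text \<open>Stated for an arbitrary record with these three fields so that it covers both
  \<open>FactAlgebra\<close> and \<open>FactModule\<close>.\<close>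

lemma (in abelian_subgroup) quotient_abelian_group:
  fixes Q :: "('a set, 'c) ring_scheme"
  assumes "carrier Q = a_rcosets H" "add Q = set_add G" "zero Q = H"
  shows "abelian_group Q"
proof (rule comm_group_abelian_groupI)
  \<comment> \<open>The group axioms read only these three fields, so they pass to any record
    extension.\<close>
  have "comm_group \<lparr>carrier = C, mult = m, one = e\<rparr> \<Longrightarrow>
      comm_group \<lparr>carrier = C, mult = m, one = e, \<dots> = z\<rparr>"
    for C :: "'a set set" and m e and z :: 'c
    unfolding comm_group_def group_def monoid_def comm_monoid_def comm_monoid_axioms_def
      group_axioms_def Units_def partial_object.simps monoid.simps .
  from this[OF a_factorgroup_is_comm_group[unfolded A_FactGroup_def']]
  show "comm_group (add_monoid Q)" using assms by simp
qed

lemma FactAlgebra_ring: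
  fixes H :: "('r, 'h, 'l) module_scheme"
  assumes "ideal J H"
  shows "ring (FactAlgebra H J)"
proof -
  interpret J: ideal J H by fact
  note eqs = FactRing_simps J.rcoset_mult_add J.a_rcos_sum J.m_assoc J.l_distr J.r_distr
  show ?thesis
  proof (rule ringI)
    show "abelian_group (FactAlgebra H J)"
      by (rule J.quotient_abelian_group) simp_all
    show "Group.monoid (FactAlgebra H J)"
      by (rule monoidI) (auto simp: eqs)
  qed (auto simp: eqs)
qed

text \<open>For representatives \<open>j + h\<close> and \<open>n + x\<close>, the product differs
  from \<open>h x\<close> by \<open>j (n + x) + h n\<close>. The first term lies in \<open>N\<close>
  by \<open>JM\<close>, the second by \<open>HN\<close>.\<close>

lemma rcoset_smult:
  fixes H :: "('r, 'h, 'l) module_scheme" and M :: "('h, 'm, 'n) module_scheme"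
  assumes "left_module H M" "ideal J H" "additive_subgroup N M"
    and HN: "\<And>h x. \<lbrakk>h \<in> carrier H; x \<in> N\<rbrakk> \<Longrightarrow> h \<odot>\<^bsub>M\<^esub> x \<in> N"
    and JM: "\<And>h x. \<lbrakk>h \<in> J; x \<in> carrier M\<rbrakk> \<Longrightarrow> h \<odot>\<^bsub>M\<^esub> x \<in> N"
    and h: "h \<in> carrier H" and x: "x \<in> carrier M"
  shows "(J +>\<^bsub>H\<^esub> h) \<odot>\<^bsub>FactModule M N\<^esub> (N +>\<^bsub>M\<^esub> x) = N +>\<^bsub>M\<^esub> (h \<odot>\<^bsub>M\<^esub> x)"
proof -
  interpret left_module H M by fact
  interpret J: ideal J H by fact
  interpret N: abelian_subgroup N M
    using assms(3) M.abelian_group_axioms by (rule abelian_subgroupI3)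
  have "N +>\<^bsub>M\<^esub> (h' \<odot>\<^bsub>M\<^esub> x') = N +>\<^bsub>M\<^esub> (h \<odot>\<^bsub>M\<^esub> x)"
    if h': "h' \<in> J +>\<^bsub>H\<^esub> h" and x': "x' \<in> N +>\<^bsub>M\<^esub> x" for h' x'
  proof -
    from h' obtain j where j: "j \<in> J" "h' = j \<oplus>\<^bsub>H\<^esub> h" by (auto simp: a_r_coset_def')
    from x' obtain n where n: "n \<in> N" "x' = n \<oplus>\<^bsub>M\<^esub> x" by (auto simp: a_r_coset_def')
    have c: "j \<in> carrier H" "n \<in> carrier M" "x' \<in> carrier M"
      using j n x by auto
    have "h' \<odot>\<^bsub>M\<^esub> x' = (j \<odot>\<^bsub>M\<^esub> x' \<oplus>\<^bsub>M\<^esub> h \<odot>\<^bsub>M\<^esub> n) \<oplus>\<^bsub>M\<^esub> h \<odot>\<^bsub>M\<^esub> x"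
      using c h x by (simp add: j(2) n(2) smult_l_distr smult_r_distr smult_closed M.a_ac)
    moreover have "j \<odot>\<^bsub>M\<^esub> x' \<oplus>\<^bsub>M\<^esub> h \<odot>\<^bsub>M\<^esub> n \<in> N"
      using HN JM c h j n by blast
    ultimately have "h' \<odot>\<^bsub>M\<^esub> x' \<in> N +>\<^bsub>M\<^esub> (h \<odot>\<^bsub>M\<^esub> x)"
      by (auto simp: a_r_coset_def')
    then show ?thesis
      using N.a_repr_independence' smult_closed[OF h x] by blast
  qed
  then have "(J +>\<^bsub>H\<^esub> h) \<odot>\<^bsub>FactModule M N\<^esub> (N +>\<^bsub>M\<^esub> x) =
      (\<Union>h'\<in>J +>\<^bsub>H\<^esub> h. \<Union>x'\<in>N +>\<^bsub>M\<^esub> x. N +>\<^bsub>M\<^esub> (h \<odot>\<^bsub>M\<^esub> x))"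
    unfolding FactModule_simps by (intro SUP_cong refl)
  \<comment> \<open>The union of a constant family is that constant only over nonempty index
    sets.\<close>
  moreover have "J +>\<^bsub>H\<^esub> h \<noteq> {}" "N +>\<^bsub>M\<^esub> x \<noteq> {}"
    using h x J.a_rcos_self N.a_rcos_self by blast+
  ultimately show ?thesis by simp
qed

lemma FactModule_left_module:
  fixes H :: "('r, 'h, 'l) module_scheme" and M :: "('h, 'm, 'n) module_scheme"
  assumes "left_module H M" "ideal J H" "additive_subgroup N M"
    and HN: "\<And>h x. \<lbrakk>h \<in> carrier H; x \<in> N\<rbrakk> \<Longrightarrow> h \<odot>\<^bsub>M\<^esub> x \<in> N"
    and JM: "\<And>h x. \<lbrakk>h \<in> J; x \<in> carrier M\<rbrakk> \<Longrightarrow> h \<odot>\<^bsub>M\<^esub> x \<in> N"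
  shows "left_module (FactAlgebra H J) (FactModule M N)"
proof -
  interpret left_module H M by fact
  interpret J: ideal J H by fact
  interpret N: abelian_subgroup N M
    using assms(3) M.abelian_group_axioms by (rule abelian_subgroupI3)
  note act = rcoset_smult[OF assms]
  note cosets = A_RCOSETS_def'
  show ?thesis
  proof (intro left_module.intro left_module_axioms.intro)
    show "ring (FactAlgebra H J)" using assms(2) by (rule FactAlgebra_ring)
    show "abelian_group (FactModule M N)" by (rule N.quotient_abelian_group) simp_all
  next
    fix A X assume "A \<in> carrier (FactAlgebra H J)" "X \<in> carrier (FactModule M N)"
    then show "A \<odot>\<^bsub>FactModule M N\<^esub> X \<in> carrier (FactModule M N)"
      by (auto simp: cosets act smult_closed simp del: FactModule_simps(4))
  next
    fix A A' X assume "A \<in> carrier (FactAlgebra H J)" "A' \<in> carrier (FactAlgebra H J)"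
      "X \<in> carrier (FactModule M N)"
    then show "(A \<oplus>\<^bsub>FactAlgebra H J\<^esub> A') \<odot>\<^bsub>FactModule M N\<^esub> X =
        A \<odot>\<^bsub>FactModule M N\<^esub> X \<oplus>\<^bsub>FactModule M N\<^esub> A' \<odot>\<^bsub>FactModule M N\<^esub> X"
      "(A \<otimes>\<^bsub>FactAlgebra H J\<^esub> A') \<odot>\<^bsub>FactModule M N\<^esub> X =
        A \<odot>\<^bsub>FactModule M N\<^esub> (A' \<odot>\<^bsub>FactModule M N\<^esub> X)"
      by (auto simp: cosets act smult_closed J.a_rcos_sum N.a_rcos_sum J.rcoset_mult_add
          smult_l_distr smult_assoc simp del: FactModule_simps(4))
  next
    fix A X X' assume "A \<in> carrier (FactAlgebra H J)" "X \<in> carrier (FactModule M N)"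
      "X' \<in> carrier (FactModule M N)"
    then show "A \<odot>\<^bsub>FactModule M N\<^esub> (X \<oplus>\<^bsub>FactModule M N\<^esub> X') =
        A \<odot>\<^bsub>FactModule M N\<^esub> X \<oplus>\<^bsub>FactModule M N\<^esub> A \<odot>\<^bsub>FactModule M N\<^esub> X'"
      by (auto simp: cosets act smult_closed N.a_rcos_sum smult_r_distr
          simp del: FactModule_simps(4))
  next
    fix X assume "X \<in> carrier (FactModule M N)"
    then show "\<one>\<^bsub>FactAlgebra H J\<^esub> \<odot>\<^bsub>FactModule M N\<^esub> X = X"
      by (auto simp: cosets act smult_one simp del: FactModule_simps(4))
  qed
qed

text \<open>Changing \<open>h\<close> by an element \<open>j\<close> of \<open>J\<close> changes
  \<open>r h\<close> by \<open>r j\<close>, which stays in \<open>J\<close>.\<close>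

lemma FactAlgebra_rcoset_smult:
  assumes "assoc_algebra R H" "ideal J H" "r \<in> carrier R" "h \<in> carrier H"
    and RJ: "\<And>x. x \<in> J \<Longrightarrow> r \<odot>\<^bsub>H\<^esub> x \<in> J"
  shows "r \<odot>\<^bsub>FactAlgebra H J\<^esub> (J +>\<^bsub>H\<^esub> h) = J +>\<^bsub>H\<^esub> (r \<odot>\<^bsub>H\<^esub> h)"
proof -
  interpret assoc_algebra R H by fact
  interpret J: ideal J H by fact
  have "J +>\<^bsub>H\<^esub> (r \<odot>\<^bsub>H\<^esub> h') = J +>\<^bsub>H\<^esub> (r \<odot>\<^bsub>H\<^esub> h)" if "h' \<in> J +>\<^bsub>H\<^esub> h" for h'
  proof -
    from that obtain j where j: "j \<in> J" "h' = j \<oplus>\<^bsub>H\<^esub> h" by (auto simp: a_r_coset_def')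
    have "r \<odot>\<^bsub>H\<^esub> h' = r \<odot>\<^bsub>H\<^esub> j \<oplus>\<^bsub>H\<^esub> r \<odot>\<^bsub>H\<^esub> h"
      using j assms(3,4) by (simp add: smult_r_distr)
    then have "r \<odot>\<^bsub>H\<^esub> h' \<in> J +>\<^bsub>H\<^esub> (r \<odot>\<^bsub>H\<^esub> h)"
      using RJ j(1) by (auto simp: a_r_coset_def')
    then show ?thesis using J.a_repr_independence' assms(3,4) by blast
  qed
  then have "r \<odot>\<^bsub>FactAlgebra H J\<^esub> (J +>\<^bsub>H\<^esub> h) =
      (\<Union>h'\<in>J +>\<^bsub>H\<^esub> h. J +>\<^bsub>H\<^esub> (r \<odot>\<^bsub>H\<^esub> h))"
    unfolding FactAlgebra_simps by (intro SUP_cong refl)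
  moreover have "J +>\<^bsub>H\<^esub> h \<noteq> {}" using assms(4) J.a_rcos_self by blast
  ultimately show ?thesis by simp
qed

lemma canonical_hom_algebra_hom:
  assumes "assoc_algebra R H" and ideals: "\<And>P. P \<in> Y \<Longrightarrow> ideal (ideal_smult P H) H"
    and sub: "\<And>P r x. \<lbrakk>P \<in> Y; r \<in> carrier R; x \<in> ideal_smult P H\<rbrakk> \<Longrightarrow>
      r \<odot>\<^bsub>H\<^esub> x \<in> ideal_smult P H"
  shows "canonical_hom H Y \<in> algebra_hom R H
    (product_algebra Y (\<lambda>P. FactAlgebra H (ideal_smult P H)))"
proof -
  interpret assoc_algebra R H by fact
  note hom = ideal.rcos_ring_hom[OF ideals]
  have "canonical_hom H Y \<in> ring_hom H (product_algebra Y (\<lambda>P. FactAlgebra H (ideal_smult P H)))"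
  proof (rule ring_hom_memI)
    fix h assume "h \<in> carrier H"
    then show "canonical_hom H Y h \<in>
        carrier (product_algebra Y (\<lambda>P. FactAlgebra H (ideal_smult P H)))"
      by (auto simp: canonical_hom_def product_algebra_def A_RCOSETS_def')
  next
    fix h h' assume "h \<in> carrier H" "h' \<in> carrier H"
    then show "canonical_hom H Y (h \<otimes>\<^bsub>H\<^esub> h') = canonical_hom H Y h
        \<otimes>\<^bsub>product_algebra Y (\<lambda>P. FactAlgebra H (ideal_smult P H))\<^esub> canonical_hom H Y h'"
      by (auto simp: canonical_hom_def product_algebra_def ideal.rcoset_mult_add[OF ideals]
          intro!: restrict_ext)
  next
    fix h h' assume "h \<in> carrier H" "h' \<in> carrier H"
    then show "canonical_hom H Y (h \<oplus>\<^bsub>H\<^esub> h') = canonical_hom H Y h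
        \<oplus>\<^bsub>product_algebra Y (\<lambda>P. FactAlgebra H (ideal_smult P H))\<^esub> canonical_hom H Y h'"
      using ring_hom_add[OF hom]
      by (auto simp: canonical_hom_def product_algebra_def FactRing_def intro!: restrict_ext)
  next
    show "canonical_hom H Y \<one>\<^bsub>H\<^esub> =
        \<one>\<^bsub>product_algebra Y (\<lambda>P. FactAlgebra H (ideal_smult P H))\<^esub>"
      by (simp add: canonical_hom_def product_algebra_def cong: restrict_cong)
  qed
  moreover have "canonical_hom H Y (r \<odot>\<^bsub>H\<^esub> h) =
      r \<odot>\<^bsub>product_algebra Y (\<lambda>P. FactAlgebra H (ideal_smult P H))\<^esub> canonical_hom H Y h"
    if "r \<in> carrier R" "h \<in> carrier H" for r h
    using that FactAlgebra_rcoset_smult[OF assms(1) ideals _ _ sub]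
    by (auto simp: canonical_hom_def product_algebra_def simp del: FactAlgebra_simps
        intro!: restrict_ext)
  ultimately show ?thesis by (simp add: algebra_hom_def)
qed

text \<open>Left and right multiplication by an element of \<open>H\<close> are both
  \<open>R\<close>-linear, since scalars commute with all of \<open>H\<close>. The image lemma then
  gives both closure conditions.\<close>

lemma (in assoc_algebra) ideal_smult_ideal:
  assumes "I \<subseteq> carrier R"
  shows "ideal (ideal_smult I H) H"
proof (rule idealI)
  show "ring H" ..
  show "subgroup (ideal_smult I H) (add_monoid H)"
    using ideal_smult_subgroup[OF assms] by (rule additive_subgroup.a_subgroup)
  fix x h assume x: "x \<in> ideal_smult I H" and h: "h \<in> carrier H"
  have "mod_hom R H H ((\<otimes>\<^bsub>H\<^esub>) h)" "mod_hom R H H (\<lambda>y. y \<otimes>\<^bsub>H\<^esub> h)"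
    using h by (auto intro!: mod_hom.intro mod_hom_axioms.intro module_axioms
        simp: module_hom_def smult_mult_left smult_mult_right r_distr l_distr)
  from this[THEN ideal_smult_image, OF assms x]
  show "h \<otimes>\<^bsub>H\<^esub> x \<in> ideal_smult I H" "x \<otimes>\<^bsub>H\<^esub> h \<in> ideal_smult I H" .
qed

lemma (in module) ideal_smult_smult_closed:
  assumes "I \<subseteq> carrier R" "r \<in> carrier R" "x \<in> ideal_smult I M"
  shows "r \<odot>\<^bsub>M\<^esub> x \<in> ideal_smult I M"
proof (rule ideal_smult_image[of R M M "(\<odot>\<^bsub>M\<^esub>) r"])
  show "mod_hom R M M ((\<odot>\<^bsub>M\<^esub>) r)"
    using assms(2) by (auto intro!: mod_hom.intro mod_hom_axioms.intro module_axioms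
        simp: module_hom_def smult_r_distr smult_assoc1[symmetric] R.m_comm)
qed (use assms in auto)

section \<open>Modules over an algebra and their reduction modulo an ideal of the base ring\<close>

locale algebra_module = A: assoc_algebra R H + L: left_module H M
  for R :: "('r, 'k) ring_scheme" and H :: "('r, 'h, 'l) module_scheme"
    and M :: "('h, 'm, 'n) module_scheme" +
  assumes restrict_module: "module R (restrict_scalars H M)"
begin

text \<open>Linearity in \<open>h\<close> holds because \<open>r h\<close> is the product of
  \<open>r 1\<close> and \<open>h\<close> in \<open>H\<close>.\<close>

lemma scalar_action_mod_hom:
  assumes "x \<in> carrier M"
  shows "mod_hom R H (restrict_scalars H M) (\<lambda>h. h \<odot>\<^bsub>M\<^esub> x)"
proof -
  have "(r \<odot>\<^bsub>H\<^esub> h) \<odot>\<^bsub>M\<^esub> x = (r \<odot>\<^bsub>H\<^esub> \<one>\<^bsub>H\<^esub>) \<odot>\<^bsub>M\<^esub> (h \<odot>\<^bsub>M\<^esub> x)" if "r \<in> carrier R" "h \<in> carrier H" for r h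
    using that assms A.smult_mult_left[of r "\<one>\<^bsub>H\<^esub>" h] by (simp flip: L.smult_assoc)
  then show ?thesis
    using assms
    by (auto intro!: mod_hom.intro mod_hom_axioms.intro A.module_axioms restrict_module
        simp: module_hom_def L.smult_closed L.smult_l_distr)
qed

text \<open>Linearity in \<open>x\<close> holds because the element \<open>r 1\<close> is central in
  \<open>H\<close>.\<close>

lemma action_mod_hom:
  assumes "h \<in> carrier H"
  shows "mod_hom R (restrict_scalars H M) (restrict_scalars H M) (\<lambda>x. h \<odot>\<^bsub>M\<^esub> x)"
proof -
  have "h \<odot>\<^bsub>M\<^esub> ((r \<odot>\<^bsub>H\<^esub> \<one>\<^bsub>H\<^esub>) \<odot>\<^bsub>M\<^esub> x) = (r \<odot>\<^bsub>H\<^esub> \<one>\<^bsub>H\<^esub>) \<odot>\<^bsub>M\<^esub> (h \<odot>\<^bsub>M\<^esub> x)"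
    if "r \<in> carrier R" "x \<in> carrier M" for r x
    using that assms A.smult_mult_left[of r "\<one>\<^bsub>H\<^esub>" h] A.smult_mult_right[of r h "\<one>\<^bsub>H\<^esub>"]
    by (simp flip: L.smult_assoc)
  then show ?thesis
    using assms
    by (auto intro!: mod_hom.intro mod_hom_axioms.intro restrict_module
        simp: module_hom_def L.smult_closed L.smult_r_distr)
qed

text \<open>The subset \<open>IM\<close> is formed with scalars from \<open>R\<close>, whereas the
  quotient is taken of \<open>M\<close> itself. The two records share their additive structure, so
  the subgroup property carries over.\<close>

lemma ideal_smult_restrict_scalars_subgroup:
  assumes "I \<subseteq> carrier R"
  shows "additive_subgroup (ideal_smult I (restrict_scalars H M)) M"
proof -
  interpret N: additive_subgroup "ideal_smult I (restrict_scalars H M)" "restrict_scalars H M"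
    using restrict_module assms by (rule module.ideal_smult_subgroup)
  show ?thesis
    using N.a_subset N.a_closed N.zero_closed N.a_inv_closed
    by (intro additive_subgroupI subgroup.intro) (auto simp flip: a_inv_def)
qed

lemma action_mem_ideal_smult:
  assumes "I \<subseteq> carrier R" "h \<in> carrier H" "x \<in> ideal_smult I (restrict_scalars H M)"
  shows "h \<odot>\<^bsub>M\<^esub> x \<in> ideal_smult I (restrict_scalars H M)"
  by (rule ideal_smult_image[OF action_mod_hom[OF assms(2)] assms(1,3)])

lemma ideal_smult_action_mem:
  assumes "I \<subseteq> carrier R" "h \<in> ideal_smult I H" "x \<in> carrier M"
  shows "h \<odot>\<^bsub>M\<^esub> x \<in> ideal_smult I (restrict_scalars H M)"
  by (rule ideal_smult_image[OF scalar_action_mod_hom[OF assms(3)] assms(1,2)])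

lemma quotient_left_module:
  assumes "I \<subseteq> carrier R"
  shows "left_module (FactAlgebra H (ideal_smult I H))
    (FactModule M (ideal_smult I (restrict_scalars H M)))"
  by (rule FactModule_left_module[OF L.left_module_axioms A.ideal_smult_ideal[OF assms]
        ideal_smult_restrict_scalars_subgroup[OF assms] action_mem_ideal_smult[OF assms]
        ideal_smult_action_mem[OF assms]])

lemma quotient_action:
  assumes "I \<subseteq> carrier R" "h \<in> carrier H" "x \<in> carrier M"
  defines "N \<equiv> ideal_smult I (restrict_scalars H M)"
  shows "(ideal_smult I H +>\<^bsub>H\<^esub> h) \<odot>\<^bsub>FactModule M N\<^esub> (N +>\<^bsub>M\<^esub> x) = N +>\<^bsub>M\<^esub> (h \<odot>\<^bsub>M\<^esub> x)"
  unfolding N_def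
  by (rule rcoset_smult[OF L.left_module_axioms A.ideal_smult_ideal[OF assms(1)]
        ideal_smult_restrict_scalars_subgroup[OF assms(1)] action_mem_ideal_smult[OF assms(1)]
        ideal_smult_action_mem[OF assms(1)] assms(2,3)])

end


subsection \<open>Residue characteristics\<close>

lemma ring_char_eq_0D:
  fixes n :: nat
  assumes "ring_char R = 0" "0 < n"
  shows "add_pow R n \<one>\<^bsub>R\<^esub> \<noteq> \<zero>\<^bsub>R\<^esub>"
proof
  assume "add_pow R n \<one>\<^bsub>R\<^esub> = \<zero>\<^bsub>R\<^esub>"
  then have ex: "\<exists>n::nat. 0 < n \<and> add_pow R n \<one>\<^bsub>R\<^esub> = \<zero>\<^bsub>R\<^esub>" using assms(2) by blast
  have "0 < ring_char R"
    unfolding ring_char_def if_P[OF ex] using LeastI_ex[OF ex] by (rule conjunct1)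
  then show False using assms(1) by simp
qed

text \<open>The \<open>n\<close>-fold sum of one in the quotient is the coset of the
  \<open>n\<close>-fold sum of one in \<open>R\<close>, and a zero coset means membership in
  \<open>I\<close>. For characteristic zero the sum is empty and the claim is that zero lies in
  \<open>I\<close>.\<close>

lemma (in ideal) ring_char_quotient_mem:
  "add_pow R (ring_char (R Quot I)) \<one> \<in> I"
proof (cases "ring_char (R Quot I) = 0")
  case False
  define p where "p = ring_char (R Quot I)"
  have ex: "\<exists>n::nat. 0 < n \<and> add_pow (R Quot I) n \<one>\<^bsub>R Quot I\<^esub> = \<zero>\<^bsub>R Quot I\<^esub>"
    using False unfolding ring_char_def by presburger
  from LeastI_ex[OF ex] have "add_pow (R Quot I) p \<one>\<^bsub>R Quot I\<^esub> = \<zero>\<^bsub>R Quot I\<^esub>"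
    using ex by (simp add: p_def ring_char_def)
  moreover have "add_pow (R Quot I) n \<one>\<^bsub>R Quot I\<^esub> = I +> add_pow R n \<one>" for n :: nat
  proof (induction n)
    case (Suc n)
    have "add_pow R n \<one> \<in> carrier R" by simp
    then show ?case using Suc by (simp add: add_pow_def FactRing_def a_rcos_sum)
  qed (simp add: add_pow_def FactRing_def a_coset_add_zero[OF a_subset])
  ultimately have "I +> add_pow R p \<one> = I" by (simp add: FactRing_def)
  then show ?thesis
    using a_rcos_self[of "add_pow R p \<one>"] by (simp add: p_def)
qed (simp add: add_pow_def)

text \<open>A positive number that is at most \<open>n\<close> divides the factorial of
  \<open>n\<close>; primality of the characteristic does not enter.\<close>

lemma (in ideal) fact_mem_of_ring_char_le:
  assumes "0 < ring_char (R Quot I)" "ring_char (R Quot I) \<le> n"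
  shows "add_pow R (fact n :: nat) \<one> \<in> I"
proof -
  obtain k where k: "fact n = ring_char (R Quot I) * k"
    using assms dvd_fact[of "ring_char (R Quot I)" n] by (auto simp: dvd_def)
  have "add_pow R j x \<in> I" if "x \<in> I" for j :: nat and x
    by (induction j) (use that in \<open>auto simp: add_pow_def\<close>)
  then have "add_pow R k (add_pow R (ring_char (R Quot I)) \<one>) \<in> I"
    using ring_char_quotient_mem by blast
  then show ?thesis unfolding k add.nat_pow_pow[OF one_closed] .
qed

subsection \<open>Matrix entries of the action\<close>

locale based_algebra_module = algebra_module R H M
  for R :: "('r, 'k) ring_scheme" and H :: "('r, 'h, 'l) module_scheme"
    and M :: "('h, 'm, 'n) module_scheme" +
  fixes BH BM
  assumes BH: "module_basis R H BH" and finite_BH: "finite BH"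
    and BM: "module_basis R (restrict_scalars H M) BM"
begin

sublocale HB: based_module R H BH
  by (intro based_module.intro based_module_axioms.intro A.module_axioms BH)

sublocale MB: based_module R "restrict_scalars H M" BM
  by (intro based_module.intro based_module_axioms.intro restrict_module BM)

text \<open>For fixed \<open>x\<close> and \<open>y\<close> this is the coefficient vector of a
  linear form in the coordinates of an element of \<open>H\<close>. The argument order makes
  \<open>entry x y\<close> a member of the family \<open>F\<close> in
  \<open>uniform_elimination\<close>. Here \<open>x\<close> ranges over all of \<open>M\<close>, so
  faithfulness applies directly.\<close>

definition entry :: "'m \<Rightarrow> 'm \<Rightarrow> 'h \<Rightarrow> 'r"
  where "entry x y b = coord R (restrict_scalars H M) BM (b \<odot>\<^bsub>M\<^esub> x) y"

lemma entry_closed: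
  assumes "x \<in> carrier M" "y \<in> BM" "b \<in> BH"
  shows "entry x y b \<in> carrier R"
  using assms HB.basis_closed unfolding entry_def
  by (intro MB.coord_closed) (auto intro: L.smult_closed)

text \<open>Composite of two \<open>R\<close>-linear maps, acting on the fixed \<open>x\<close> and
  then taking the \<open>y\<close>-coordinate, evaluated on a combination of basis elements.\<close>

lemma coord_action:
  assumes x: "x \<in> carrier M" and y: "y \<in> BM" and r: "r \<in> BH \<rightarrow> carrier R"
  shows "coord R (restrict_scalars H M) BM (A.lincomb r BH \<odot>\<^bsub>M\<^esub> x) y =
    (\<Oplus>\<^bsub>R\<^esub>b\<in>BH. entry x y b \<otimes>\<^bsub>R\<^esub> r b)"
proof -
  let ?M = "restrict_scalars H M"
  interpret act: mod_hom R H ?M "\<lambda>h. h \<odot>\<^bsub>M\<^esub> x" using x by (rule scalar_action_mod_hom)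
  have bx: "b \<in> carrier H" "b \<odot>\<^bsub>M\<^esub> x \<in> carrier ?M" "r b \<in> carrier R" if "b \<in> BH" for b
    using that HB.basis_closed act.f_im r by auto
  have "A.lincomb r BH \<odot>\<^bsub>M\<^esub> x = (\<Oplus>\<^bsub>?M\<^esub>b\<in>BH. (r b \<odot>\<^bsub>H\<^esub> b) \<odot>\<^bsub>M\<^esub> x)"
    unfolding A.lincomb_def using bx HB.basis_closed by (intro act.hom_sum) auto
  also have "\<dots> = (\<Oplus>\<^bsub>?M\<^esub>b\<in>BH. r b \<odot>\<^bsub>?M\<^esub> (b \<odot>\<^bsub>M\<^esub> x))"
    using bx MB.smult_closed act.f_smult by (intro MB.M.finsum_cong') blast+
  finally have "coord R ?M BM (A.lincomb r BH \<odot>\<^bsub>M\<^esub> x) y =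
      coord R ?M BM (\<Oplus>\<^bsub>?M\<^esub>b\<in>BH. r b \<odot>\<^bsub>?M\<^esub> (b \<odot>\<^bsub>M\<^esub> x)) y" by simp
  also have "\<dots> = (\<Oplus>\<^bsub>R\<^esub>b\<in>BH. coord R ?M BM (r b \<odot>\<^bsub>?M\<^esub> (b \<odot>\<^bsub>M\<^esub> x)) y)"
    using bx MB.smult_closed y finite_BH by (intro MB.coord_finsum) blast+
  also have "\<dots> = (\<Oplus>\<^bsub>R\<^esub>b\<in>BH. entry x y b \<otimes>\<^bsub>R\<^esub> r b)"
  proof (intro A.R.finsum_cong' refl)
    fix b assume b: "b \<in> BH"
    have "coord R ?M BM (r b \<odot>\<^bsub>?M\<^esub> (b \<odot>\<^bsub>M\<^esub> x)) y = r b \<otimes>\<^bsub>R\<^esub> entry x y b"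
      unfolding entry_def using bx[OF b] y by (intro MB.coord_smult)
    then show "coord R ?M BM (r b \<odot>\<^bsub>?M\<^esub> (b \<odot>\<^bsub>M\<^esub> x)) y = entry x y b \<otimes>\<^bsub>R\<^esub> r b"
      using A.R.m_comm entry_closed[OF x y b] bx(3)[OF b] by simp
  qed (use entry_closed[OF x y] bx(3) in blast)
  finally show ?thesis .
qed

text \<open>Supplies the hypothesis of \<open>uniform_elimination\<close>. If all forms vanish, the
  element of \<open>H\<close> with coordinates \<open>r\<close> kills \<open>M\<close>, so it is
  zero and its coordinates vanish.\<close>

lemma entries_separate:
  assumes faithful: "faithful_module H M" and r: "r \<in> BH \<rightarrow> carrier R"
    and zero: "\<And>x y. \<lbrakk>x \<in> carrier M; y \<in> BM\<rbrakk> \<Longrightarrow>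
      (\<Oplus>\<^bsub>R\<^esub>b\<in>BH. entry x y b \<otimes>\<^bsub>R\<^esub> r b) = \<zero>\<^bsub>R\<^esub>"
  shows "\<forall>b\<in>BH. r b = \<zero>\<^bsub>R\<^esub>"
proof -
  have h: "A.lincomb r BH \<in> carrier H" using r HB.basis_closed by auto
  have "A.lincomb r BH \<odot>\<^bsub>M\<^esub> x = \<zero>\<^bsub>M\<^esub>" if x: "x \<in> carrier M" for x
    using MB.coord_all_zero[of "A.lincomb r BH \<odot>\<^bsub>M\<^esub> x"] coord_action[OF x _ r] zero[OF x]
      L.smult_closed[OF h x] by simp
  then have "A.lincomb r BH = \<zero>\<^bsub>H\<^esub>"
    using faithful_module.faithful[OF faithful h] by blast
  then show ?thesis
    using HB.coord_lincomb[OF finite_BH r] HB.coord_zero by metis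
qed

text \<open>If the coset of \<open>h\<close> kills the quotient, then every \<open>h x\<close> lies
  in \<open>IM\<close>, so all forms take values in \<open>I\<close> at the coordinates of
  \<open>h\<close>. By \<open>detect\<close> these coordinates lie in \<open>I\<close>, which places
  \<open>h\<close> in \<open>IH\<close>.\<close>

lemma quotient_faithful:
  assumes I: "ideal I R"
    and detect: "\<And>r. \<lbrakk>r \<in> BH \<rightarrow> carrier R; \<And>x y. \<lbrakk>x \<in> carrier M; y \<in> BM\<rbrakk> \<Longrightarrow>
      (\<Oplus>\<^bsub>R\<^esub>b\<in>BH. entry x y b \<otimes>\<^bsub>R\<^esub> r b) \<in> I\<rbrakk> \<Longrightarrow> \<forall>b\<in>BH. r b \<in> I"
  shows "faithful_module (FactAlgebra H (ideal_smult I H))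
    (FactModule M (ideal_smult I (restrict_scalars H M)))"
proof -
  define J where "J = ideal_smult I H"
  define N where "N = ideal_smult I (restrict_scalars H M)"
  interpret I: ideal I R by fact
  interpret J: ideal J H unfolding J_def using I.a_subset by (rule A.ideal_smult_ideal)
  interpret N: abelian_subgroup N M
    unfolding N_def using ideal_smult_restrict_scalars_subgroup[OF I.a_subset]
      L.M.abelian_group_axioms by (rule abelian_subgroupI3)
  have "faithful_module (FactAlgebra H J) (FactModule M N)"
  proof (intro faithful_module.intro faithful_module_axioms.intro)
    show "left_module (FactAlgebra H J) (FactModule M N)"
      unfolding J_def N_def using I.a_subset by (rule quotient_left_module)
    fix X assume "X \<in> carrier (FactAlgebra H J)"
      and kill: "\<And>Z. Z \<in> carrier (FactModule M N) \<Longrightarrow>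
        X \<odot>\<^bsub>FactModule M N\<^esub> Z = \<zero>\<^bsub>FactModule M N\<^esub>"
    then obtain h where h: "h \<in> carrier H" "X = J +>\<^bsub>H\<^esub> h"
      by (auto simp: A_RCOSETS_def')
    have hx: "h \<odot>\<^bsub>M\<^esub> x \<in> N" if x: "x \<in> carrier M" for x
    proof -
      have "N +>\<^bsub>M\<^esub> x \<in> carrier (FactModule M N)"
        using x by (auto simp: A_RCOSETS_def')
      then have "N +>\<^bsub>M\<^esub> (h \<odot>\<^bsub>M\<^esub> x) = N"
        using kill quotient_action[OF I.a_subset h(1) x] unfolding h(2) J_def N_def by simp
      then show ?thesis using N.a_rcos_self[OF L.smult_closed[OF h(1) x]] by simp
    qed
    define r where "r = coord R H BH h"
    have r: "r \<in> BH \<rightarrow> carrier R" using HB.coord_closed[OF h(1)] by (auto simp: r_def)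
    have "A.lincomb r BH = h" unfolding r_def using HB.coord_expansion[OF finite_BH h(1)] by simp
    then have "(\<Oplus>\<^bsub>R\<^esub>b\<in>BH. entry x y b \<otimes>\<^bsub>R\<^esub> r b) \<in> I" if "x \<in> carrier M" "y \<in> BM" for x y
      using MB.coord_mem_of_ideal_smult[OF I hx[OF that(1), unfolded N_def] that(2)]
        coord_action[OF that r] by simp
    then have "\<forall>b\<in>BH. r b \<in> I" using detect[OF r] by blast
    then have "h \<in> J"
      unfolding J_def r_def using h(1) by (intro HB.ideal_smult_of_coord_mem I finite_BH) auto
    then show "X = \<zero>\<^bsub>FactAlgebra H J\<^esub>" using J.a_rcos_const h(2) by simp
  qed
  then show ?thesis by (simp add: J_def N_def)
qed

text \<open>The difference of two elements with equal images lies in \<open>PH\<close> for all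
  \<open>P\<close> in \<open>Y\<close>, so its coordinates lie in the intersection of
  \<open>Y\<close>. The intersection is taken with the carrier because that of an empty family is
  the whole type.\<close>

lemma canonical_hom_inj:
  assumes ideals: "\<And>P. P \<in> Y \<Longrightarrow> ideal P R"
    and Y: "carrier R \<inter> \<Inter>Y \<subseteq> {\<zero>\<^bsub>R\<^esub>}"
  shows "inj_on (canonical_hom H Y) (carrier H)"
proof (rule inj_onI)
  fix h h' assume h: "h \<in> carrier H" "h' \<in> carrier H"
    and eq: "canonical_hom H Y h = canonical_hom H Y h'"
  define k where "k = h \<oplus>\<^bsub>H\<^esub> \<ominus>\<^bsub>H\<^esub> h'"
  have k: "k \<in> carrier H" using h by (simp add: k_def)
  have "coord R H BH k b \<in> P" if P: "P \<in> Y" and b: "b \<in> BH" for P b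
  proof -
    interpret P: ideal P R using ideals P .
    interpret J: ideal "ideal_smult P H" H using P.a_subset by (rule A.ideal_smult_ideal)
    have "ideal_smult P H +>\<^bsub>H\<^esub> h = ideal_smult P H +>\<^bsub>H\<^esub> h'"
      using fun_cong[OF eq, of P] P by (simp add: canonical_hom_def)
    then have "h \<in> ideal_smult P H +>\<^bsub>H\<^esub> h'" using J.a_rcos_self[OF h(1)] by simp
    then have "k \<in> ideal_smult P H" using J.a_rcos_module h by (simp add: k_def)
    then show ?thesis using HB.coord_mem_of_ideal_smult[OF ideals[OF P] _ b] by blast
  qed
  then have "coord R H BH k b = \<zero>\<^bsub>R\<^esub>" if "b \<in> BH" for b
    using Y that HB.coord_closed[OF k that] by blast
  then have "k = \<zero>\<^bsub>H\<^esub>" using HB.coord_all_zero[OF k] by blast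
  then show "h = h'" using h A.M.minus_equality A.M.minus_minus
    by (metis A.M.a_inv_closed k_def)
qed

end

section \<open>Choice of the maximal ideals\<close>

theorem proposition2:
  fixes R :: "('r, 'k) ring_scheme"
    and H :: "('r, 'h, 'l) module_scheme"
    and M :: "('h, 'm, 'n) module_scheme"
    and q :: real
  assumes "domain R"
    and "ring_char R = 0"
    and "jacobson_radical R = {\<zero>\<^bsub>R\<^esub>}"
    and "\<And>\<mm>. maximalideal \<mm> R \<Longrightarrow> ring_char (R Quot \<mm>) > 0"
    and "assoc_algebra R H"
    and "free_module_finite_rank R H"
    and "faithful_module H M"
    and "free_module R (restrict_scalars H M)"
    and "q > 1"
  shows "\<exists>Y. (\<forall>\<mm>\<in>Y. maximalideal \<mm> R) \<and>
    (\<forall>\<mm>\<in>Y. faithful_module (FactAlgebra H (ideal_smult \<mm> H))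
                 (FactModule M (ideal_smult \<mm> (restrict_scalars H M)))) \<and>
    (\<forall>\<mm>\<in>Y. real (ring_char (R Quot \<mm>)) > q) \<and>
    canonical_hom H Y \<in> algebra_hom R H
      (product_algebra Y (\<lambda>\<mm>. FactAlgebra H (ideal_smult \<mm> H))) \<and>
    inj_on (canonical_hom H Y) (carrier H)"
proof -
  interpret R: domain R by fact
  obtain BH where basis_H: "module_basis R H BH" "finite BH"
    using assms(6) unfolding free_module_finite_rank_def by blast
  obtain BM where basis_M: "module_basis R (restrict_scalars H M) BM"
    using assms(8) unfolding free_module_def by blast
  \<comment> \<open>The \<open>R\<close>-module structure on \<open>M\<close> is read off from its
    basis, since \<open>module_basis\<close> includes it.\<close>
  interpret based_algebra_module R H M BH BM
    using basis_H basis_M assms(5) faithful_module.axioms(1)[OF assms(7)]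
    by (intro based_algebra_module.intro algebra_module.intro algebra_module_axioms.intro
        based_algebra_module_axioms.intro) (auto simp: module_basis_def)
  let ?F = "{entry x y |x y. x \<in> carrier M \<and> y \<in> BM}"
  have "?F \<subseteq> BH \<rightarrow> carrier R" using entry_closed by auto
  moreover have "\<forall>b\<in>BH. r b = \<zero>\<^bsub>R\<^esub>"
    if r: "r \<in> BH \<rightarrow> carrier R"
      and "\<And>a. a \<in> ?F \<Longrightarrow> (\<Oplus>\<^bsub>R\<^esub>b\<in>BH. a b \<otimes>\<^bsub>R\<^esub> r b) = \<zero>\<^bsub>R\<^esub>" for r
    using that(2) by (intro entries_separate[OF assms(7) r]) blast
  ultimately obtain d where d: "d \<in> carrier R" "d \<noteq> \<zero>\<^bsub>R\<^esub>"
    and detect: "\<And>P r. \<lbrakk>primeideal P R; d \<notin> P; r \<in> BH \<rightarrow> carrier R;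
      \<forall>a\<in>?F. (\<Oplus>\<^bsub>R\<^esub>b\<in>BH. a b \<otimes>\<^bsub>R\<^esub> r b) \<in> P\<rbrakk> \<Longrightarrow> \<forall>b\<in>BH. r b \<in> P"
    using R.uniform_elimination[OF finite_BH, of ?F] by blast
  \<comment> \<open>This image of a factorial in \<open>R\<close> is nonzero because
    \<open>R\<close> has characteristic zero.\<close>
  define n where "n = add_pow R (fact (nat \<lfloor>q\<rfloor>) :: nat) \<one>\<^bsub>R\<^esub>"
  have n: "n \<in> carrier R" "n \<noteq> \<zero>\<^bsub>R\<^esub>"
    using ring_char_eq_0D[OF assms(2), of "fact (nat \<lfloor>q\<rfloor>)"] by (simp_all add: n_def)
  define Y where "Y = {P. maximalideal P R \<and> d \<otimes>\<^bsub>R\<^esub> n \<notin> P}"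
  have Y: "maximalideal P R" "ideal P R" "primeideal P R" "d \<notin> P" "n \<notin> P" if "P \<in> Y" for P
  proof -
    show P: "maximalideal P R" using that by (simp add: Y_def)
    then show "primeideal P R" by (rule R.maximalideal_prime)
    from P interpret P: maximalideal P R .
    show "ideal P R" ..
    show "d \<notin> P" "n \<notin> P"
      using that d n P.I_l_closed P.I_r_closed by (auto simp: Y_def)
  qed
  have "faithful_module (FactAlgebra H (ideal_smult P H))
      (FactModule M (ideal_smult P (restrict_scalars H M)))" if "P \<in> Y" for P
    using detect[OF Y(3,4)[OF that]] by (intro quotient_faithful Y(2)[OF that]) blast
  moreover have "real (ring_char (R Quot P)) > q" if "P \<in> Y" for P
  proof (rule ccontr)
    assume "\<not> real (ring_char (R Quot P)) > q"
    \<comment> \<open>A characteristic is an integer, so one not above \<open>q\<close> is at most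
      its floor. It is positive by hypothesis, so it divides the factorial and forces
      \<open>n\<close> into \<open>P\<close>.\<close>
    then have "ring_char (R Quot P) \<le> nat \<lfloor>q\<rfloor>" by linarith
    then have "n \<in> P"
      unfolding n_def
      using ideal.fact_mem_of_ring_char_le[OF Y(2)[OF that] assms(4)[OF Y(1)[OF that]]] by blast
    then show False using Y(5)[OF that] by blast
  qed
  moreover have "canonical_hom H Y \<in> algebra_hom R H
      (product_algebra Y (\<lambda>P. FactAlgebra H (ideal_smult P H)))"
    using ideal.Icarr[OF Y(2)]
    by (intro canonical_hom_algebra_hom assms(5) A.ideal_smult_ideal A.ideal_smult_smult_closed)
      auto
  moreover have "inj_on (canonical_hom H Y) (carrier H)"
  proof (intro canonical_hom_inj Y(2) subsetI)
    fix r assume "r \<in> carrier R \<inter> \<Inter>Y"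
    then have r: "r \<in> carrier R" "r \<in> \<Inter>Y" by auto
    let ?c = "d \<otimes>\<^bsub>R\<^esub> n"
    have c: "?c \<in> carrier R" "?c \<noteq> \<zero>\<^bsub>R\<^esub>" using d n by (auto simp: R.integral_iff)
    \<comment> \<open>Each maximal ideal contains one of the two factors: either it contains
      \<open>?c\<close>, or it belongs to \<open>Y\<close> and contains \<open>r\<close>. The
      product is therefore in the Jacobson radical, which is zero, and \<open>?c\<close> cancels in
      the domain.\<close>
    have "?c \<otimes>\<^bsub>R\<^esub> r \<in> P" if P: "maximalideal P R" for P
    proof -
      interpret P: maximalideal P R by fact
      show ?thesis
      proof (cases "?c \<in> P")
        case True
        then show ?thesis using r(1) by (rule P.I_r_closed)
      next
        case False
        then have "r \<in> P" using r(2) P by (auto simp: Y_def)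
        then show ?thesis using c(1) by (rule P.I_l_closed)
      qed
    qed
    then have "?c \<otimes>\<^bsub>R\<^esub> r \<in> jacobson_radical R"
      using c(1) r(1) by (auto simp: jacobson_radical_def)
    then show "r \<in> {\<zero>\<^bsub>R\<^esub>}" using assms(3) R.integral[OF _ c(1) r(1)] c(2) by auto
  qed
  ultimately show ?thesis using Y(1) by (intro exI[of _ Y]) blast
qed

end
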